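(* Let $G=(V_G,E_G)$ be a hypergraph with $V_G=\{0,1,\dots,p\}\subset\mathbb{N}_0$ and $E_G$ a finite (multi)collection of nonempty subsets of $V_G$. Write each edge as the tuple of its nodes in strictly ascending order, order the edges in descending lexicographic order (a proper prefix of a tuple being lexicographically smaller than the tuple), and let $T$ be the concatenation of these tuples in that order, a string of length $M_G=\sum_{e\in E_G}|e|$; thus each edge occupies a block of consecutive positions $k,k+1,\dots,k+r-1$ of $T$. Let $SA$ be the suffix array of $T$ and $SA^{-1}$ its inverse. Define the permutation $\Psi$ of $\{0,\dots,M_G-1\}$ by: if $SA[i]$ is not the last position of its edge block, $\Psi[i]=SA^{-1}[SA[i]+1]$; if $SA[i]$ is the last position of the edge block starting at position $k$, $\Psi[i]=SA^{-1}[k]$. Then the sequence $\Psi[0],\Psi[1],\dots,\Psi[M_G-1]$ is a concatenation of at most $|V_G|$ contiguous strictly increasing subsequences.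
   Context: For a string $T$ of length $n$, $T[i..]$ is the suffix starting at position $i$; the suffix array $SA$ is the permutation of $\{0,\dots,n-1\}$ such that $T[SA[0]..]<T[SA[1]..]<\cdots<T[SA[n-1]..]$ in lexicographic order (a proper prefix being smaller). The collection $E_G$ may contain repeated edges; each edge contains each node once. With this definition, repeated application of $\Psi$ starting from a suffix-array position cycles through the suffix-array positions of the nodes of exactly one edge. *)

theory Defs
  imports "HOL-Library.Multiset" "HOL-Library.List_Lexorder" "HOL-Combinatorics.Permutations"
begin

definition hypergraph :: "nat set \<Rightarrow> nat set multiset \<Rightarrow> bool" where
  "hypergraph V E \<longleftrightarrow> (\<exists>p. V = {0..p}) \<and> (\<forall>e\<in>#E. e \<noteq> {} \<and> e \<subseteq> V)"

text \<open>
  The order on lists is the one of \<^theory>\<open>HOL-Library.List_Lexorder\<close>: lexicographic, with a proper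
  prefix being smaller. It is used for the edge tuples and for the suffixes.
\<close>

definition edge_tuples :: "nat set multiset \<Rightarrow> nat list list" where
  "edge_tuples E = rev (sorted_list_of_multiset (image_mset sorted_list_of_set E))"

definition edge_text :: "nat set multiset \<Rightarrow> nat list" where
  "edge_text E = concat (edge_tuples E)"

definition total_size :: "nat set multiset \<Rightarrow> nat" where
  "total_size E = (\<Sum>e\<in>#E. card e)"

definition is_suffix_array :: "'a::linorder list \<Rightarrow> (nat \<Rightarrow> nat) \<Rightarrow> bool" where
  "is_suffix_array T sa \<longleftrightarrow> sa permutes {..<length T} \<and>
     (\<forall>i j. i < j \<longrightarrow> j < length T \<longrightarrow> drop (sa i) T < drop (sa j) T)"

definition suffix_array :: "'a::linorder list \<Rightarrow> nat \<Rightarrow> nat" where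
  "suffix_array T = (THE sa. is_suffix_array T sa)"

text \<open>
  The block of the \<open>m\<close>-th tuple of \<open>ts\<close> in \<open>concat ts\<close> consists of the positions \<open>q\<close> with
  \<open>block_start ts m \<le> q < block_start ts (Suc m)\<close>.
\<close>

definition block_start :: "'a list list \<Rightarrow> nat \<Rightarrow> nat" where
  "block_start ts m = length (concat (take m ts))"

definition block_of :: "'a list list \<Rightarrow> nat \<Rightarrow> nat" where
  "block_of ts q =
     (THE m. m < length ts \<and> block_start ts m \<le> q \<and> q < block_start ts (Suc m))"

definition Psi :: "nat set multiset \<Rightarrow> nat \<Rightarrow> nat" where
  "Psi E i =
     (let ts = edge_tuples E; SA = suffix_array (edge_text E); q = SA i; m = block_of ts q
      in if q + 1 < block_start ts (Suc m) then inv SA (q + 1) else inv SA (block_start ts m))"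

lemma length_edge_text:
  assumes "hypergraph V E"
  shows "length (edge_text E) = total_size E"
proof -
  have "length (edge_text E) = sum_mset (image_mset length (mset (edge_tuples E)))"
    by (simp add: edge_text_def length_concat flip: sum_mset_sum_list)
  also have "\<dots> = (\<Sum>e\<in>#E. length (sorted_list_of_set e))"
    by (simp add: edge_tuples_def image_mset.compositionality comp_def)
  finally show ?thesis by (simp add: total_size_def)
qed

lemma suffix_array_exists: "\<exists>sa. is_suffix_array T sa"
proof -
  let ?n = "length T"
  define xs where "xs = sort_key (\<lambda>i. drop i T) [0..<?n]"
  define sa where "sa i = (if i < ?n then xs ! i else i)" for i
  have len: "length xs = ?n" and set: "set xs = {..<?n}" and dist: "distinct xs"
    by (auto simp: xs_def)
  have "bij_betw (\<lambda>i. xs ! i) {..<?n} {..<?n}"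
    using bij_betw_nth[OF dist] len set by simp
  then have "bij_betw sa {..<?n} {..<?n}"
    by (rule bij_betw_cong[THEN iffD1, rotated]) (simp add: sa_def)
  then have perm: "sa permutes {..<?n}"
    by (rule bij_imp_permutes) (simp add: sa_def)
  have "drop (sa i) T < drop (sa j) T" if "i < j" "j < ?n" for i j
  proof -
    have le: "drop (xs ! i) T \<le> drop (xs ! j) T"
      using sorted_nth_mono[of "map (\<lambda>i. drop i T) xs" i j] that len
      by (simp add: xs_def)
    have "xs ! i \<noteq> xs ! j" using dist that len by (simp add: nth_eq_iff_index_eq)
    moreover have "xs ! i < ?n" "xs ! j < ?n"
      using nth_mem[of i xs] nth_mem[of j xs] that len set by auto
    ultimately have "length (drop (xs ! i) T) \<noteq> length (drop (xs ! j) T)" by auto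
    with le have "drop (xs ! i) T < drop (xs ! j) T" by (metis order_le_less)
    then show ?thesis using that by (simp add: sa_def)
  qed
  with perm show ?thesis unfolding is_suffix_array_def by blast
qed

lemma suffix_array_unique:
  assumes f: "is_suffix_array T f" and g: "is_suffix_array T g"
  shows "f = g"
proof -
  let ?n = "length T"
  let ?l = "\<lambda>h. map (\<lambda>i. drop (h i) T) [0..<?n]"
  have srt: "sorted (?l h) \<and> distinct (?l h) \<and> set (?l h) = (\<lambda>i. drop i T) ` {..<?n}"
    if h: "is_suffix_array T h" for h
  proof (intro conjI)
    have p: "h permutes {..<?n}" and l: "\<And>i j. i < j \<Longrightarrow> j < ?n \<Longrightarrow> drop (h i) T < drop (h j) T"
      using h by (auto simp: is_suffix_array_def)
    have s: "sorted_wrt (<) (?l h)" by (simp add: sorted_wrt_iff_nth_less l)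
    then show "sorted (?l h)" "distinct (?l h)" by (auto simp: strict_sorted_iff)
    have "set (?l h) = (\<lambda>i. drop i T) ` h ` {..<?n}" by (auto simp: image_image)
    then show "set (?l h) = (\<lambda>i. drop i T) ` {..<?n}" by (simp add: permutes_image[OF p])
  qed
  have eq: "?l f = ?l g"
    using srt[OF f] srt[OF g] sorted_distinct_set_unique[of "?l f" "?l g"] by auto
  have pf: "f permutes {..<?n}" and pg: "g permutes {..<?n}"
    using f g by (auto simp: is_suffix_array_def)
  show ?thesis
  proof
    fix i
    show "f i = g i"
    proof (cases "i < ?n")
      case True
      then have "drop (f i) T = drop (g i) T" using arg_cong[OF eq, of "\<lambda>l. l ! i"] by simp
      then have "?n - f i = ?n - g i" by (metis length_drop)
      moreover have "f i < ?n" "g i < ?n"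
        using True permutes_in_image[OF pf] permutes_in_image[OF pg] by auto
      ultimately show ?thesis by simp
    next
      case False
      then show ?thesis using pf pg by (simp add: permutes_def)
    qed
  qed
qed

lemma is_suffix_array_suffix_array: "is_suffix_array T (suffix_array T)"
  unfolding suffix_array_def
  using theI'[of "is_suffix_array T"] suffix_array_exists suffix_array_unique by metis

lemma block_start_mono: "m \<le> m' \<Longrightarrow> block_start ts m \<le> block_start ts m'"
proof -
  assume "m \<le> m'"
  then obtain d where "m' = m + d" using le_Suc_ex by blast
  then show ?thesis by (simp add: block_start_def take_add)
qed

lemma block_of_eq:
  assumes "m < length ts" "block_start ts m \<le> q" "q < block_start ts (Suc m)"
  shows "block_of ts q = m"
  unfolding block_of_def
proof (rule the_equality)
  show "m < length ts \<and> block_start ts m \<le> q \<and> q < block_start ts (Suc m)"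
    using assms by simp
next
  fix m' assume m': "m' < length ts \<and> block_start ts m' \<le> q \<and> q < block_start ts (Suc m')"
  have "\<not> m' < m" using block_start_mono[of "Suc m'" m ts] m' assms by auto
  moreover have "\<not> m < m'" using block_start_mono[of "Suc m" m' ts] m' assms by auto
  ultimately show "m' = m" by simp
qed

lemma block_exists:
  assumes "q < length (concat ts)"
  shows "\<exists>m<length ts. block_start ts m \<le> q \<and> q < block_start ts (Suc m)"
proof -
  have "q < block_start ts (length ts)" using assms by (simp add: block_start_def)
  moreover define k where "k = (LEAST k. q < block_start ts k)"
  ultimately have k: "q < block_start ts k" "k \<le> length ts"
    by (auto intro: LeastI Least_le)
  have "k \<noteq> 0" using k(1) by (cases k) (auto simp: block_start_def)
  then obtain m where m: "k = Suc m" using not0_implies_Suc by blast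
  have "\<not> q < block_start ts m" using not_less_Least[of m "\<lambda>k. q < block_start ts k"] m k_def by auto
  then show ?thesis using k m by (intro exI[of _ m]) auto
qed

lemma Psi_permutation:
  "bij_betw (Psi E) {..<length (edge_text E)} {..<length (edge_text E)}"
proof -
  let ?n = "length (edge_text E)"
  let ?ts = "edge_tuples E"
  let ?b = "block_start ?ts"
  let ?SA = "suffix_array (edge_text E)"
  define nx where "nx q = (if q + 1 < ?b (Suc (block_of ?ts q)) then q + 1 else ?b (block_of ?ts q))"
    for q
  have p: "?SA permutes {..<?n}"
    using is_suffix_array_suffix_array[of "edge_text E"] by (simp add: is_suffix_array_def)
  have Psi: "Psi E = inv ?SA \<circ> (nx \<circ> ?SA)"
    by (rule ext) (simp add: Psi_def nx_def Let_def)
  have blk: "block_of ?ts q < length ?ts \<and> ?b (block_of ?ts q) \<le> q \<and> q < ?b (Suc (block_of ?ts q))"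
    if q: "q < ?n" for q
  proof -
    obtain m where "m < length ?ts" "?b m \<le> q" "q < ?b (Suc m)"
      using block_exists[of q ?ts] q by (auto simp: edge_text_def)
    then show ?thesis using block_of_eq[of m ?ts q] by simp
  qed
  have nx: "nx q < ?n \<and> block_of ?ts (nx q) = block_of ?ts q" if q: "q < ?n" for q
  proof -
    let ?m = "block_of ?ts q"
    note B = blk[OF q]
    have r: "?b ?m \<le> nx q" "nx q < ?b (Suc ?m)" using B by (auto simp: nx_def)
    have "?b (Suc ?m) \<le> ?b (length ?ts)" using B by (intro block_start_mono) auto
    then have "?b (Suc ?m) \<le> ?n" by (simp add: block_start_def edge_text_def)
    then show ?thesis using r B block_of_eq[of ?m ?ts "nx q"] by auto
  qed
  have "inj_on nx {..<?n}"
  proof (rule inj_onI)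
    fix x y assume x: "x \<in> {..<?n}" and y: "y \<in> {..<?n}" and e: "nx x = nx y"
    have m: "block_of ?ts x = block_of ?ts y" using nx[of x] nx[of y] x y e by auto
    then show "x = y" using e blk[of x] blk[of y] x y by (auto simp: nx_def split: if_splits)
  qed
  moreover have "nx ` {..<?n} \<subseteq> {..<?n}" using nx by auto
  ultimately have "bij_betw nx {..<?n} {..<?n}"
    by (simp add: bij_betw_def endo_inj_surj)
  then show ?thesis unfolding Psi
    using permutes_imp_bij[OF p] permutes_imp_bij[OF permutes_inv[OF p]]
    by (intro bij_betw_trans[of _ _ "{..<?n}"]) 
qed

end

theory Submission
  imports Defs "HOL-Library.Sublist"
begin

text \<open>
  It suffices that \<open>\<Psi>\<close> is strictly increasing on the suffix-array positions whose suffixes share a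
  first letter \<open>c\<close>, since these form at most \<open>|V|\<close> consecutive intervals. Let \<open>q\<close> and \<open>q'\<close> be text
  positions carrying \<open>c\<close> with \<open>T[q..] < T[q'..]\<close>. If
  neither ends its edge, delete the common letter. Inside an edge the letter after \<open>c\<close> exceeds \<open>c\<close>,
  whereas the first letter of the edge and that of every later edge are at most \<open>c\<close>. This settles
  the cases in which exactly one of \<open>q\<close>, \<open>q'\<close> ends its edge. If both do, the next edges start at
  suffixes ordered like \<open>T[q..]\<close> and \<open>T[q'..]\<close>; as the suffixes at edge starts are strictly
  decreasing from left to right, the suffixes at the starts of the two edges themselves are ordered
  in the same way.
\<close>

section \<open>Lexicographic comparison of concatenated tuples\<close>

lemma append_less_append_same: "us @ xs < us @ ys \<longleftrightarrow> xs < (ys :: 'a::linorder list)"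
  by (induction us) auto

text \<open>The first mismatch between \<open>us\<close> and \<open>ts\<close> decides the order,
  and nothing appended afterwards can change it.\<close>

lemma append_less_appendI:
  fixes us :: "'a::linorder list"
  assumes "us < ts" "\<not> prefix us ts"
  shows "us @ xs < ts @ ys"
  using assms
proof (induction us arbitrary: ts)
  case (Cons u us)
  then show ?case by (cases ts) auto
qed simp

text \<open>First letters are compared only for nonempty \<open>xs\<close>, because the left side
  may be the empty text after the last edge.\<close>

lemma less_if_hd_less:
  fixes xs :: "'a::linorder list"
  assumes "ys \<noteq> []" "xs \<noteq> [] \<Longrightarrow> hd xs < hd ys"
  shows "xs < ys"
  using assms by (cases xs; cases ys) auto

lemma hd_mono:
  fixes xs :: "'a::linorder list"
  assumes "xs \<le> ys" "xs \<noteq> []"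
  shows "hd xs \<le> hd ys"
  using assms by (cases xs; cases ys) auto

lemma hd_concat_le:
  fixes t :: "'a::linorder list"
  assumes "\<forall>u\<in>set ts. u \<noteq> [] \<and> u \<le> t" "concat ts \<noteq> []"
  shows "hd (concat ts) \<le> hd t"
  using assms by (cases ts) (auto simp: hd_append intro: hd_mono)

text \<open>By induction, \<open>t\<close> is compared with the next tuple \<open>u\<close>. If they
  are equal, cancelling \<open>t\<close> leaves the induction hypothesis; if \<open>u\<close> is
  smaller without being a prefix, their mismatch decides. A proper prefix \<open>u\<close> is the
  case that needs ascending tuples.\<close>

lemma concat_less_append_concat:
  fixes t :: "'a::linorder list"
  assumes "sorted_wrt (\<ge>) (t # ts)" "\<forall>u\<in>set (t # ts). u \<noteq> [] \<and> sorted_wrt (<) u"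
  shows "concat ts < t @ concat ts"
  using assms
proof (induction ts arbitrary: t)
  case Nil
  then show ?case by (cases t) auto
next
  case (Cons u ts)
  have IH: "concat ts < u @ concat ts" using Cons by simp
  have "u \<le> t" using Cons.prems by simp
  then consider "u = t" | "u < t" "\<not> prefix u t" | x xs where "t = u @ x # xs"
    by (metis append_Nil2 neq_Nil_conv order_le_less prefixE)
  then have "u @ concat ts < t @ u @ concat ts"
  proof cases
    case 1
    then show ?thesis using IH by (simp add: append_less_append_same)
  next
    case 2
    then show ?thesis by (rule append_less_appendI)
  next
    case 3
    \<comment> \<open>After \<open>u\<close> is cancelled, the right side begins with
      \<open>x\<close>, which exceeds \<open>hd u\<close> because \<open>t\<close> ascends, while
      every tuple in \<open>ts\<close> is at most \<open>u\<close> and so begins with at most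
      \<open>hd u\<close>.\<close>
    have u: "u \<noteq> []" using Cons.prems by simp
    then have "hd u < x" using Cons.prems 3 by (cases u) auto
    moreover have "hd (concat ts) \<le> hd u" if "concat ts \<noteq> []"
      using that Cons.prems by (intro hd_concat_le) auto
    ultimately have "concat ts < x # xs @ u @ concat ts"
      by (intro less_if_hd_less) auto
    then show ?thesis using 3 by (simp add: append_less_append_same)
  qed
  then show ?case by simp
qed


text \<open>Chains the previous comparison over consecutive edges. Admitting
  \<open>m' = length ts\<close> includes the empty suffix behind the last edge.\<close>

lemma concat_drop_less:
  fixes ts :: "'a::linorder list list"
  assumes "sorted_wrt (\<ge>) ts" "\<forall>u\<in>set ts. u \<noteq> [] \<and> sorted_wrt (<) u"
    and "m < m'" "m' \<le> length ts"
  shows "concat (drop m' ts) < concat (drop m ts)"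
proof -
  have step: "concat (drop (Suc k) ts) < concat (drop k ts)" if "k < length ts" for k
  proof -
    have d: "drop k ts = ts ! k # drop (Suc k) ts" using that by (simp add: Cons_nth_drop_Suc)
    have "concat (drop (Suc k) ts) < ts ! k @ concat (drop (Suc k) ts)"
      using assms(1,2) d sorted_wrt_drop[of "(\<ge>)" ts k] in_set_dropD[of _ k ts]
      by (intro concat_less_append_concat) auto
    then show ?thesis using d by simp
  qed
  from assms(3,4) show ?thesis
  proof (induction m')
    case (Suc k)
    then show ?case using step[of k] by (cases "m = k") auto
  qed simp
qed

section \<open>Positions, blocks and the cyclic successor\<close>

lemma block_start_Suc:
  assumes "m < length ts"
  shows "block_start ts (Suc m) = block_start ts m + length (ts ! m)"
  using assms by (simp add: block_start_def take_Suc_conv_app_nth)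

lemma drop_block:
  assumes "m < length ts" "r \<le> length (ts ! m)"
  shows "drop (block_start ts m + r) (concat ts) = drop r (ts ! m) @ concat (drop (Suc m) ts)"
proof -
  have "concat ts = concat (take m ts) @ ts ! m @ concat (drop (Suc m) ts)"
    using assms(1) by (metis concat.simps(2) concat_append id_take_nth_drop)
  then show ?thesis using assms(2) by (simp add: block_start_def)
qed

text \<open>In a sorted list each level set is a contiguous segment: once a value reaches
  \<open>N\<close>, no later value is below \<open>N\<close>.\<close>

lemma concat_filter_eq_level:
  fixes f :: "'a \<Rightarrow> nat"
  assumes "sorted (map f xs)"
  shows "concat (map (\<lambda>v. filter (\<lambda>x. f x = v) xs) [0..<N]) = filter (\<lambda>x. f x < N) xs"
proof (induction N)
  case (Suc N)
  have "filter (\<lambda>x. f x < N) xs @ filter (\<lambda>x. f x = N) xs = filter (\<lambda>x. f x < Suc N) xs"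
    using assms
  proof (induction xs)
    case (Cons x xs)
    show ?case
    proof (cases "f x < N")
      case False
      then have "filter (\<lambda>x. f x < N) xs = []" using Cons.prems by (auto simp: filter_empty_conv)
      then show ?thesis using Cons False by auto
    qed (use Cons in auto)
  qed simp
  then show ?case using Suc by simp
qed simp

text \<open>The part of \<open>Psi\<close> that acts on text positions, separated so that it can be
  studied on the text alone.\<close>

definition cyclic_next :: "'a list list \<Rightarrow> nat \<Rightarrow> nat" where
  "cyclic_next ts q =
     (let m = block_of ts q
      in if q + 1 < block_start ts (Suc m) then q + 1 else block_start ts m)"

lemma Psi_eq_cyclic_next:
  "Psi E i = inv (suffix_array (edge_text E)) (cyclic_next (edge_tuples E) (suffix_array (edge_text E) i))"
  by (simp add: Psi_def cyclic_next_def Let_def)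

text \<open>Gives a position the coordinates edge \<open>m\<close> and offset \<open>r\<close>; at
  the last offset the successor wraps to offset 0.\<close>

lemma block_decomposition:
  assumes "q < length (concat ts)"
  obtains m r where "m < length ts" "r < length (ts ! m)" "q = block_start ts m + r"
    "concat ts ! q = ts ! m ! r"
    "cyclic_next ts q = block_start ts m + (if Suc r < length (ts ! m) then Suc r else 0)"
    "drop q (concat ts) = ts ! m ! r # drop (Suc r) (ts ! m) @ concat (drop (Suc m) ts)"
proof -
  obtain m where m: "m < length ts" "block_start ts m \<le> q" "q < block_start ts (Suc m)"
    using block_exists[OF assms] by blast
  define r where "r = q - block_start ts m"
  have r: "r < length (ts ! m)" "q = block_start ts m + r"
    using m block_start_Suc[OF m(1)] by (auto simp: r_def)
  have d: "drop q (concat ts) = ts ! m ! r # drop (Suc r) (ts ! m) @ concat (drop (Suc m) ts)"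
    using drop_block[OF m(1), of r] r by (simp flip: Cons_nth_drop_Suc)
  have "concat ts ! q = ts ! m ! r" using d assms by (metis hd_drop_conv_nth list.sel(1))
  moreover have "cyclic_next ts q = block_start ts m + (if Suc r < length (ts ! m) then Suc r else 0)"
    using block_of_eq[OF m] block_start_Suc[OF m(1)] r(2) by (simp add: cyclic_next_def)
  ultimately show thesis using that m(1) r d by blast
qed

lemma cyclic_next_less:
  assumes "q < length (concat ts)"
  shows "cyclic_next ts q < length (concat ts)"
proof -
  obtain m r where m: "m < length ts" "r < length (ts ! m)"
    "cyclic_next ts q = block_start ts m + (if Suc r < length (ts ! m) then Suc r else 0)"
    using block_decomposition[OF assms] by metis
  then have "cyclic_next ts q < block_start ts (Suc m)" by (auto simp: block_start_Suc)
  also have "\<dots> \<le> block_start ts (length ts)" using m by (intro block_start_mono) simp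
  finally show ?thesis by (simp add: block_start_def)
qed

lemma drop_cyclic_next_mono:
  fixes ts :: "'a::linorder list list"
  assumes desc: "sorted_wrt (\<ge>) ts" and asc: "\<forall>u\<in>set ts. u \<noteq> [] \<and> sorted_wrt (<) u"
    and q: "q < length (concat ts)" and q': "q' < length (concat ts)"
    and letter: "concat ts ! q = concat ts ! q'"
    and less: "drop q (concat ts) < drop q' (concat ts)"
  shows "drop (cyclic_next ts q) (concat ts) < drop (cyclic_next ts q') (concat ts)"
proof -
  obtain m r where m: "m < length ts" "r < length (ts ! m)"
    "concat ts ! q = ts ! m ! r"
    "cyclic_next ts q = block_start ts m + (if Suc r < length (ts ! m) then Suc r else 0)"
    "drop q (concat ts) = ts ! m ! r # drop (Suc r) (ts ! m) @ concat (drop (Suc m) ts)"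
    using block_decomposition[OF q] by metis
  obtain m' r' where m': "m' < length ts" "r' < length (ts ! m')"
    "concat ts ! q' = ts ! m' ! r'"
    "cyclic_next ts q' = block_start ts m' + (if Suc r' < length (ts ! m') then Suc r' else 0)"
    "drop q' (concat ts) = ts ! m' ! r' # drop (Suc r') (ts ! m') @ concat (drop (Suc m') ts)"
    using block_decomposition[OF q'] by metis
  have tails: "drop (Suc r) (ts ! m) @ concat (drop (Suc m) ts)
      < drop (Suc r') (ts ! m') @ concat (drop (Suc m') ts)"
    using less letter m(3,5) m'(3,5) by simp
  have hd_le: "hd (ts ! k) \<le> ts ! k ! s" if "k < length ts" "s < length (ts ! k)" for k s
  proof (cases s)
    case 0
    then show ?thesis using that by (simp add: hd_conv_nth)
  next
    case (Suc s')
    have "sorted_wrt (<) (ts ! k)" using asc that by simp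
    from sorted_wrt_nth_less[OF this, of 0 s] show ?thesis
      using that Suc by (simp add: hd_conv_nth flip: length_greater_0_conv)
  qed
  have later: "hd (concat (drop (Suc k) ts)) \<le> hd (ts ! k)"
    if "k < length ts" "concat (drop (Suc k) ts) \<noteq> []" for k
  proof (rule hd_concat_le)
    have "sorted_wrt (\<ge>) (ts ! k # drop (Suc k) ts)"
      using desc that(1) sorted_wrt_drop[of "(\<ge>)" ts k] by (simp add: Cons_nth_drop_Suc)
    then show "\<forall>u\<in>set (drop (Suc k) ts). u \<noteq> [] \<and> u \<le> ts ! k"
      using asc by (auto dest: in_set_dropD)
  qed (fact that(2))
  have inner: "ts ! k ! s < ts ! k ! Suc s" if "k < length ts" "Suc s < length (ts ! k)" for k s
    using asc that by (simp add: sorted_wrt_nth_less)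
  show ?thesis
  proof (cases "Suc r < length (ts ! m)")
    case True
    \<comment> \<open>If only \<open>q'\<close> ended its edge, the text after \<open>q'\<close>
      would be empty or begin with at most the common letter, and the text after \<open>q\<close>
      with a larger one, contradicting \<open>tails\<close>. So both successors advance, and
      \<open>tails\<close> is the claim.\<close>
    have "Suc r' < length (ts ! m')"
    proof (rule ccontr)
      assume "\<not> Suc r' < length (ts ! m')"
      then have "drop (Suc r) (ts ! m) @ concat (drop (Suc m) ts) < concat (drop (Suc m') ts)"
        using tails by simp
      moreover have "concat (drop (Suc m') ts) < drop (Suc r) (ts ! m) @ concat (drop (Suc m) ts)"
      proof (rule less_if_hd_less)
        assume "concat (drop (Suc m') ts) \<noteq> []"
        then have "hd (concat (drop (Suc m') ts)) \<le> ts ! m' ! r'"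
          using later hd_le m'(1,2) by (meson order_trans)
        also have "\<dots> < ts ! m ! Suc r" using inner m True m'(3) letter by metis
        finally show "hd (concat (drop (Suc m') ts))
            < hd (drop (Suc r) (ts ! m) @ concat (drop (Suc m) ts))"
          using True by (simp add: hd_drop_conv_nth)
      qed (use True in simp)
      ultimately show False by simp
    qed
    then show ?thesis using True tails m m'
      by (simp add: drop_block del: add_Suc_right)
  next
    case False
    then have s: "drop (cyclic_next ts q) (concat ts) = ts ! m @ concat (drop (Suc m) ts)"
      using m drop_block[of m ts 0] by simp
    show ?thesis
    proof (cases "Suc r' < length (ts ! m')")
      case True
      \<comment> \<open>Here \<open>q\<close> returns to a letter at most the common one, while
        \<open>q'\<close> advances to a larger letter.\<close>
      have "ts ! m @ concat (drop (Suc m) ts)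
          < drop (Suc r') (ts ! m') @ concat (drop (Suc m') ts)"
      proof (rule less_if_hd_less)
        have "hd (ts ! m) \<le> ts ! m' ! r'" using hd_le m(1-3) m'(3) letter by metis
        also have "\<dots> < ts ! m' ! Suc r'" using inner m' True by simp
        finally show "hd (ts ! m @ concat (drop (Suc m) ts))
            < hd (drop (Suc r') (ts ! m') @ concat (drop (Suc m') ts))"
          using True asc m(1) by (simp add: hd_drop_conv_nth)
      qed (use True in simp)
      then show ?thesis using s True m' by (simp add: drop_block del: add_Suc_right)
    next
      case last': False
      \<comment> \<open>Both tails are suffixes at edge boundaries, so strict decrease is used
        twice: backwards on the boundaries after the edges to get \<open>m' < m\<close>, then
        forwards on the starts of the edges.\<close>
      have "concat (drop (Suc m) ts) < concat (drop (Suc m') ts)"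
        using tails False last' by simp
      then have "m' < m"
        using concat_drop_less[OF desc asc, of "Suc m" "Suc m'"] m(1) m'(1)
        by (metis Suc_leI Suc_less_eq less_asym less_irrefl linorder_neqE_nat)
      then have "concat (drop m ts) < concat (drop m' ts)"
        using concat_drop_less[OF desc asc] m(1) by simp
      moreover have "drop (cyclic_next ts q') (concat ts) = ts ! m' @ concat (drop (Suc m') ts)"
        using last' m' drop_block[of m' ts 0] by simp
      ultimately show ?thesis using s m(1) m'(1) by (simp flip: Cons_nth_drop_Suc)
    qed
  qed
qed

section \<open>Transfer to the suffix array and assembly of the runs\<close>

lemma inv_suffix_array_less:
  assumes "a < length T" "b < length T" "drop a T < drop b T"
  shows "inv (suffix_array T) a < inv (suffix_array T) b"
proof (rule ccontr)
  let ?SA = "suffix_array T"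
  have p: "?SA permutes {..<length T}"
    and mono: "\<And>i j. i < j \<Longrightarrow> j < length T \<Longrightarrow> drop (?SA i) T < drop (?SA j) T"
    using is_suffix_array_suffix_array[of T] by (auto simp: is_suffix_array_def)
  assume "\<not> inv ?SA a < inv ?SA b"
  then consider "inv ?SA a = inv ?SA b" | "inv ?SA b < inv ?SA a" by linarith
  then show False
  proof cases
    case 1
    then have "a = b" by (metis p permutes_inverses(1))
    then show False using assms by simp
  next
    case 2
    have "inv ?SA a < length T"
      using permutes_in_image[OF permutes_inv[OF p], of a] assms(1) by simp
    from mono[OF 2 this] show False using assms(3) permutes_inverses(1)[OF p] by simp
  qed
qed

lemma edge_tuples_desc: "sorted_wrt (\<ge>) (edge_tuples E)"
  by (simp add: edge_tuples_def sorted_wrt_rev)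

lemma set_edge_tuples: "set (edge_tuples E) = sorted_list_of_set ` set_mset E"
  by (simp add: edge_tuples_def)

lemma hypergraph_finite_edge: "hypergraph V E \<Longrightarrow> e \<in># E \<Longrightarrow> finite e"
  unfolding hypergraph_def by (meson finite_atLeastAtMost finite_subset)

lemma edge_tuples_asc:
  assumes "hypergraph V E"
  shows "\<forall>u\<in>set (edge_tuples E). u \<noteq> [] \<and> sorted_wrt (<) u"
  using assms hypergraph_finite_edge[OF assms] by (auto simp: set_edge_tuples hypergraph_def)

lemma set_edge_text:
  assumes "hypergraph V E"
  shows "set (edge_text E) \<subseteq> V"
  using assms hypergraph_finite_edge[OF assms]
  by (auto simp: edge_text_def set_edge_tuples hypergraph_def)

lemma Psi_less_Psi:
  assumes "hypergraph V E" "i < j" "j < length (edge_text E)"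
    and "edge_text E ! suffix_array (edge_text E) i = edge_text E ! suffix_array (edge_text E) j"
  shows "Psi E i < Psi E j"
proof -
  let ?T = "edge_text E" and ?ts = "edge_tuples E"
  let ?SA = "suffix_array ?T"
  have p: "?SA permutes {..<length ?T}" and less: "drop (?SA i) ?T < drop (?SA j) ?T"
    using is_suffix_array_suffix_array[of ?T] assms(2,3) by (auto simp: is_suffix_array_def)
  have SA: "?SA i < length (concat ?ts)" "?SA j < length (concat ?ts)"
    using permutes_in_image[OF p] assms(2,3) by (auto simp: edge_text_def)
  have "drop (cyclic_next ?ts (?SA i)) ?T < drop (cyclic_next ?ts (?SA j)) ?T"
    using drop_cyclic_next_mono[OF edge_tuples_desc edge_tuples_asc[OF assms(1)] SA]
      assms(4) less by (simp add: edge_text_def)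
  then show ?thesis
    unfolding Psi_eq_cyclic_next
    using cyclic_next_less[OF SA(1)] cyclic_next_less[OF SA(2)]
    by (intro inv_suffix_array_less) (auto simp: edge_text_def)
qed

theorem theorem2:
  fixes V :: "nat set" and E :: "nat set multiset"
  assumes "hypergraph V E"
  shows "\<exists>runs :: nat list list.
           concat runs = map (Psi E) [0..<total_size E] \<and>
           length runs \<le> card V \<and>
           (\<forall>r\<in>set runs. sorted_wrt (<) r)"
proof -
  let ?T = "edge_text E"
  let ?SA = "suffix_array ?T"
  let ?n = "length ?T"
  define f where "f i = ?T ! ?SA i" for i
  \<comment> \<open>\<open>level v\<close> collects the ranks of the suffixes beginning with
    \<open>v\<close>. It may be empty; the levels for \<open>0\<close> to \<open>p\<close> yield
    exactly \<open>card V\<close> runs.\<close>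
  define level where "level v = filter (\<lambda>i. f i = v) [0..<?n]" for v
  obtain p where V: "V = {0..p}" using assms by (auto simp: hypergraph_def)
  have SA: "?SA permutes {..<?n}"
    and less: "\<And>i j. i < j \<Longrightarrow> j < ?n \<Longrightarrow> drop (?SA i) ?T < drop (?SA j) ?T"
    using is_suffix_array_suffix_array[of ?T] by (auto simp: is_suffix_array_def)
  have in_T: "?SA i < ?n" if "i < ?n" for i
    using permutes_in_image[OF SA] that by simp
  \<comment> \<open>First letters of increasing suffixes never decrease, so the levels in order of
    \<open>v\<close> list all ranks in order.\<close>
  have "f i \<le> f j" if "i < j" "j < ?n" for i j
    using hd_mono[OF less_imp_le[OF less[OF that]]] in_T[of i] in_T[of j] that
    by (simp add: f_def hd_drop_conv_nth)
  then have "sorted_wrt (\<lambda>i j. f i \<le> f j) [0..<?n]"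
    by (simp add: sorted_wrt_iff_nth_less)
  then have "concat (map level [0..<Suc p]) = filter (\<lambda>i. f i < Suc p) [0..<?n]"
    unfolding level_def by (intro concat_filter_eq_level) (simp add: sorted_map)
  also have "\<dots> = [0..<?n]"
  proof (rule filter_True, rule ballI)
    fix i assume "i \<in> set [0..<?n]"
    then have "f i \<in> V" using set_edge_text[OF assms] in_T[of i] nth_mem unfolding f_def by force
    then show "f i < Suc p" by (simp add: V)
  qed
  finally have levels: "concat (map level [0..<Suc p]) = [0..<?n]" .
  have "sorted_wrt (<) (map (Psi E) (level v))" for v
  proof -
    have "sorted_wrt (<) (level v)" unfolding level_def by (intro sorted_wrt_filter) simp
    then have "sorted_wrt (\<lambda>i j. Psi E i < Psi E j) (level v)"
      by (rule sorted_wrt_mono_rel[rotated])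
        (auto simp: level_def f_def intro: Psi_less_Psi[OF assms])
    then show ?thesis by (simp add: sorted_wrt_map)
  qed
  then have "\<forall>r\<in>set (map (map (Psi E) \<circ> level) [0..<Suc p]). sorted_wrt (<) r" by auto
  moreover have "concat (map (map (Psi E) \<circ> level) [0..<Suc p]) = map (Psi E) [0..<total_size E]"
    using arg_cong[OF levels, of "map (Psi E)"]
    by (simp only: length_edge_text[OF assms] map_concat map_map)
  moreover have "length (map (map (Psi E) \<circ> level) [0..<Suc p]) \<le> card V" by (simp add: V)
  ultimately show ?thesis by blast
qed

end
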